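(* Let $n>3$ be an integer, let $f_{1,n}(x)=x^{n-1}+2x^{n-2}+3x^{n-3}+\cdots+(n-1)x+n$, let $D(f_{1,n}(x))$ be its discriminant, and let $K_n$ be the minimal splitting field of $f_{1,n}(x)$ over $\mathbb{Q}$. Write $n=4l$, $4l+1$, $4l+2$ or $4l+3$ with $l$ an integer, and, in the cases $n\equiv 1$ or $2\pmod 4$, assume that $2l+1$ is not the square of a rational integer. Then $K_n$ contains the quadratic field $F=\mathbb{Q}(\sqrt{D(f_{1,n}(x))})$ as a subfield, and $$F=\begin{cases}\mathbb{Q}(\sqrt{-2l}) & (n=4l)\\ \mathbb{Q}(\sqrt{2l+1}) & (n=4l+1)\\ \mathbb{Q}(\sqrt{2l+1}) & (n=4l+2)\\ \mathbb{Q}(\sqrt{-2(l+1)}) & (n=4l+3).\end{cases}$$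
   Context: For a positive integer $n$, $f_{1,n}(x)=\sum_{k=1}^{n} k\,x^{n-k}\in\mathbb{Z}[x]$, a monic polynomial of degree $n-1$. The discriminant of a monic polynomial with roots $\alpha_1,\dots,\alpha_d$ is $\prod_{i<j}(\alpha_i-\alpha_j)^2$. *)

theory Defs
  imports
    Complex_Main
    "HOL-Computational_Algebra.Computational_Algebra"
    "HOL-Algebra.Algebraic_Closure_Type"
    "HOL-Algebra.Generated_Fields"
begin

definition f1 :: "nat \<Rightarrow> int poly" where
  "f1 n = (\<Sum>k=1..n. monom (int k) (n - k))"

(* Meant for monic p: for other polynomials the power of the leading coefficient is missing.
   The roots are listed with multiplicity; by discriminant_prod_linear below the order in
   which they are listed is irrelevant. *)
definition discriminant :: "complex poly \<Rightarrow> complex" where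
  "discriminant p =
     (let \<alpha> = (SOME xs. mset xs = proots p)
      in \<Prod>j<length \<alpha>. \<Prod>i<j. (\<alpha> ! i - \<alpha> ! j)\<^sup>2)"

abbreviation complex_ring :: "complex ring" where
  "complex_ring \<equiv> ring_of_type_algebra"

definition Q_adjoin :: "complex set \<Rightarrow> complex set" where
  "Q_adjoin S = generate_field complex_ring (\<rat> \<union> S)"

(* Meant for p with rational coefficients: the minimal splitting field over the rationals,
   realised inside the complex numbers. *)
definition splitting_field :: "complex poly \<Rightarrow> complex set" where
  "splitting_field p = Q_adjoin {z. poly p z = 0}"

definition quadratic_field :: "complex set \<Rightarrow> bool" where
  "quadratic_field F \<longleftrightarrow>
     subfield F complex_ring \<and> ring.dimension complex_ring 2 \<rat> F"

lemma prod_root_differences_Cons: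
  fixes x :: complex
  shows "(\<Prod>j<length (x # xs). \<Prod>i<j. ((x # xs) ! i - (x # xs) ! j)\<^sup>2) =
         (\<Prod>y\<in>#mset xs. (x - y)\<^sup>2) * (\<Prod>j<length xs. \<Prod>i<j. (xs ! i - xs ! j)\<^sup>2)"
proof -
  have "(\<Prod>y\<in>#mset xs. (x - y)\<^sup>2) = (\<Prod>j<length xs. (x - xs ! j)\<^sup>2)"
    by (induction xs) (simp_all del: prod.lessThan_Suc add: prod.lessThan_Suc_shift)
  then show ?thesis
    by (simp del: prod.lessThan_Suc add: prod.lessThan_Suc_shift prod.distrib)
qed

lemma prod_root_differences_mset_cong:
  fixes xs ys :: "complex list"
  assumes "mset xs = mset ys"
  shows "(\<Prod>j<length xs. \<Prod>i<j. (xs ! i - xs ! j)\<^sup>2) =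
         (\<Prod>j<length ys. \<Prod>i<j. (ys ! i - ys ! j)\<^sup>2)"
proof -
  define d :: "complex list \<Rightarrow> complex"
    where "d = (\<lambda>xs. \<Prod>j<length xs. \<Prod>i<j. (xs ! i - xs ! j)\<^sup>2)"
  have d_Cons: "d (x # xs) = (\<Prod>y\<in>#mset xs. (x - y)\<^sup>2) * d xs" for x xs
    unfolding d_def by (rule prod_root_differences_Cons)
  have d_mid: "d (us @ x # vs) = (\<Prod>y\<in>#mset (us @ vs). (x - y)\<^sup>2) * d (us @ vs)" for us x vs
    by (induction us) (simp_all add: d_Cons power2_commute)
  have "d xs = d ys"
    using assms
  proof (induction xs arbitrary: ys)
    case (Cons x xs)
    have "x \<in> set ys"
      using Cons.prems by (metis list.set_intros(1) set_mset_mset)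
    then obtain us vs where ys: "ys = us @ x # vs"
      by (meson split_list)
    have eq: "mset xs = mset (us @ vs)"
      using Cons.prems by (simp add: ys)
    show ?case
      unfolding ys d_Cons d_mid eq Cons.IH[OF eq] ..
  qed simp
  then show ?thesis
    unfolding d_def .
qed

lemma discriminant_prod_linear:
  fixes \<alpha> :: "nat \<Rightarrow> complex"
  shows "discriminant (\<Prod>i<d. [:- \<alpha> i, 1:]) = (\<Prod>j<d. \<Prod>i<j. (\<alpha> i - \<alpha> j)\<^sup>2)"
proof -
  let ?p = "\<Prod>i<d. [:- \<alpha> i, 1:]"
  have p: "mset (map \<alpha> [0..<d]) = proots ?p"
  proof (induction d)
    case (Suc d)
    have "(\<Prod>i<d. [:- \<alpha> i, 1:]) \<noteq> 0" by simp
    then have "proots ((\<Prod>i<d. [:- \<alpha> i, 1:]) * [:- \<alpha> d, 1:]) =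
        proots (\<Prod>i<d. [:- \<alpha> i, 1:]) + {#\<alpha> d#}"
      by (subst proots_mult) auto
    with Suc show ?case by (simp del: mult_pCons_right)
  qed simp
  have "mset (SOME xs. mset xs = proots ?p) = mset (map \<alpha> [0..<d])"
    unfolding p by (rule someI) (rule p)
  from prod_root_differences_mset_cong[OF this] show ?thesis
    unfolding discriminant_def Let_def by simp
qed

end

theory Submission
  imports Defs
begin

text \<open>
  The polynomial \<open>f = f1 n\<close> satisfies \<open>(x - 1)\<^sup>2 f(x) = x\<^bsup>n+1\<^esup> - (n + 1) x + n\<close>. Differentiating at a
  root \<open>a\<close> of \<open>f\<close> and eliminating \<open>a\<^bsup>n+1\<^esup>\<close> gives \<open>a (a - 1) f'(a) = n (n + 1)\<close>. Multiplying over all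
  roots, with \<open>f(0) = n\<close> and \<open>f(1) = n (n + 1) / 2\<close>, the discriminant is
  \<open>2 n\<^bsup>n-3\<^esup> (n + 1)\<^bsup>n-2\<^esup>\<close> up to the sign determined by \<open>(n - 1) choose 2\<close>. Removing square factors
  leaves \<open>2 n\<close> or \<open>2 (n + 1)\<close>, depending on the parity of \<open>n\<close>.
\<close>

section \<open>The complex numbers as a ring record, and fields generated over the rationals\<close>

lemma complex_ring_simps [simp]:
  "carrier complex_ring = UNIV"
  "x \<otimes>\<^bsub>complex_ring\<^esub> y = x * y"
  "x \<oplus>\<^bsub>complex_ring\<^esub> y = x + y"
  "\<zero>\<^bsub>complex_ring\<^esub> = 0"
  "\<one>\<^bsub>complex_ring\<^esub> = 1"
  by (simp_all add: ring_of_type_algebra_def)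

lemma field_complex_ring: "field complex_ring"
  by (rule field_from_type_algebra)

lemma a_inv_complex_ring [simp]: "\<ominus>\<^bsub>complex_ring\<^esub> x = - x"
proof -
  interpret field complex_ring by (rule field_complex_ring)
  show ?thesis
    by (rule minus_equality) auto
qed

lemma m_inv_complex_ring [simp]:
  assumes "x \<noteq> 0"
  shows "inv\<^bsub>complex_ring\<^esub> x = inverse x"
proof -
  interpret field complex_ring by (rule field_complex_ring)
  show ?thesis
    using assms by (intro comm_inv_char) auto
qed

lemma subfield_complex_ringI:
  assumes "1 \<in> K"
    and "\<And>x y. x \<in> K \<Longrightarrow> y \<in> K \<Longrightarrow> x + y \<in> K"
    and "\<And>x y. x \<in> K \<Longrightarrow> y \<in> K \<Longrightarrow> x * y \<in> K"
    and "\<And>x. x \<in> K \<Longrightarrow> - x \<in> K"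
    and "\<And>x. x \<in> K \<Longrightarrow> x \<noteq> 0 \<Longrightarrow> inverse x \<in> K"
  shows "subfield K complex_ring"
proof -
  interpret field complex_ring by (rule field_complex_ring)
  show ?thesis
    using assms by (intro subfieldI' subringI) auto
qed

lemma subfield_Q_adjoin: "subfield (Q_adjoin S) complex_ring"
proof -
  interpret field complex_ring by (rule field_complex_ring)
  show ?thesis
    unfolding Q_adjoin_def by (rule generate_field_is_subfield) simp
qed

lemma Q_adjoin_least:
  assumes "subfield K complex_ring" and "\<rat> \<subseteq> K" and "S \<subseteq> K"
  shows "Q_adjoin S \<subseteq> K"
proof -
  interpret field complex_ring by (rule field_complex_ring)
  show ?thesis
    unfolding Q_adjoin_def using assms by (intro generate_field_min_subfield1) auto
qed

lemma Rats_in_Q_adjoin: "x \<in> \<rat> \<Longrightarrow> x \<in> Q_adjoin S"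
  and generator_in_Q_adjoin: "x \<in> S \<Longrightarrow> x \<in> Q_adjoin S"
  unfolding Q_adjoin_def by (simp_all add: generate_field.incl)

lemma Q_adjoin_add: "x \<in> Q_adjoin S \<Longrightarrow> y \<in> Q_adjoin S \<Longrightarrow> x + y \<in> Q_adjoin S"
  and Q_adjoin_mult: "x \<in> Q_adjoin S \<Longrightarrow> y \<in> Q_adjoin S \<Longrightarrow> x * y \<in> Q_adjoin S"
  and Q_adjoin_uminus: "x \<in> Q_adjoin S \<Longrightarrow> - x \<in> Q_adjoin S"
  unfolding Q_adjoin_def
  using generate_field.eng_add[of _ complex_ring] generate_field.eng_mult[of _ complex_ring]
    generate_field.a_inv[of _ complex_ring]
  by force+

lemma Q_adjoin_diff: "x \<in> Q_adjoin S \<Longrightarrow> y \<in> Q_adjoin S \<Longrightarrow> x - y \<in> Q_adjoin S"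
  using Q_adjoin_add[of x S "- y"] Q_adjoin_uminus[of y S] by simp

lemma Q_adjoin_prod: "(\<And>i. i \<in> I \<Longrightarrow> f i \<in> Q_adjoin S) \<Longrightarrow> prod f I \<in> Q_adjoin S"
  by (induction I rule: infinite_finite_induct) (auto intro: Q_adjoin_mult Rats_in_Q_adjoin)

text \<open>Comparing two generated fields reduces to locating the generators of one inside the
  other.\<close>

lemma Q_adjoin_mono: "S \<subseteq> Q_adjoin T \<Longrightarrow> Q_adjoin S \<subseteq> Q_adjoin T"
  by (intro Q_adjoin_least subfield_Q_adjoin) (auto intro: Rats_in_Q_adjoin)

lemma Q_adjoin_mult_rat:
  assumes "q \<in> \<rat>" and "q \<noteq> 0"
  shows "Q_adjoin {q * s} = Q_adjoin {s}"
proof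
  show "Q_adjoin {q * s} \<subseteq> Q_adjoin {s}"
    using assms by (intro Q_adjoin_mono) (auto intro: Q_adjoin_mult Rats_in_Q_adjoin generator_in_Q_adjoin)
  have "inverse q * (q * s) \<in> Q_adjoin {q * s}"
    using assms(1) by (intro Q_adjoin_mult[where y = "q * s"] Rats_in_Q_adjoin generator_in_Q_adjoin)
      simp_all
  also have "inverse q * (q * s) = s"
    using assms(2) by simp
  finally show "Q_adjoin {s} \<subseteq> Q_adjoin {q * s}"
    by (intro Q_adjoin_mono) simp
qed

text \<open>The principal root is not multiplicative, but both candidates have the same square and
  so agree up to sign; the rational factor \<open>c\<close> or \<open>- c\<close> does not change
  the field.\<close>

lemma Q_adjoin_csqrt_mult_square:
  assumes "c \<in> \<rat>" and "c \<noteq> 0"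
  shows "Q_adjoin {csqrt (c\<^sup>2 * z)} = Q_adjoin {csqrt z}"
proof -
  have "(csqrt (c\<^sup>2 * z))\<^sup>2 = (c * csqrt z)\<^sup>2"
    by (simp add: power_mult_distrib)
  then have "csqrt (c\<^sup>2 * z) = c * csqrt z \<or> csqrt (c\<^sup>2 * z) = (- c) * csqrt z"
    by (simp only: power2_eq_iff minus_mult_left)
  with assms Q_adjoin_mult_rat[of c] Q_adjoin_mult_rat[of "- c"] show ?thesis
    by auto
qed

section \<open>Quadratic extensions of the rationals\<close>

text \<open>The rational span \<open>G\<close> of \<open>s\<close> and \<open>1\<close> is already a
  field, so it equals the generated field, and \<open>s \<notin> \<rat>\<close> makes the two
  vectors independent.\<close>

lemma quadratic_field_Q_adjoin:
  assumes "s\<^sup>2 \<in> \<rat>" and "s \<notin> \<rat>"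
  shows "quadratic_field (Q_adjoin {s})"
proof -
  interpret field complex_ring by (rule field_complex_ring)
  define G where "G = {a * s + b | a b. a \<in> \<rat> \<and> b \<in> \<rat>}"
  have G_I: "a * s + b \<in> G" if "a \<in> \<rat>" "b \<in> \<rat>" for a b
    using that unfolding G_def by blast
  \<comment> \<open>Dimension is built up by adjoining one vector at a time: first \<open>1\<close>
    to the zero space, then \<open>s\<close> to the rationals.\<close>
  have line_1: "line_extension \<rat> 1 {0} = \<rat>"
    by (auto simp: line_extension_mem_iff)
  have G_eq: "line_extension \<rat> s (line_extension \<rat> 1 {0}) = G"
    unfolding line_1 G_def by (fastforce simp: line_extension_mem_iff)
  have "subfield G complex_ring"
  proof (rule subfield_complex_ringI)
    show "1 \<in> G"
      using G_I[of 0 1] by simp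
  next
    fix x y assume "x \<in> G" "y \<in> G"
    then obtain a b c d where xy: "x = a * s + b" "y = c * s + d"
      and rat: "a \<in> \<rat>" "b \<in> \<rat>" "c \<in> \<rat>" "d \<in> \<rat>"
      unfolding G_def by blast
    have "x + y = (a + c) * s + (b + d)"
      by (simp add: xy algebra_simps)
    then show "x + y \<in> G"
      using rat by (simp only: G_I Rats_add)
    have "x * y = (a * d + b * c) * s + (a * c * s\<^sup>2 + b * d)"
      by (simp add: xy algebra_simps power2_eq_square)
    then show "x * y \<in> G"
      using rat assms(1) by (simp only: G_I Rats_add Rats_mult)
  next
    fix x assume "x \<in> G"
    then obtain a b where x: "x = a * s + b" and rat: "a \<in> \<rat>" "b \<in> \<rat>"
      unfolding G_def by blast
    have "- x = (- a) * s + (- b)"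
      by (simp add: x)
    then show "- x \<in> G"
      using rat by (simp only: G_I Rats_minus_iff[THEN iffD2])
    \<comment> \<open>The norm of \<open>x\<close>: the product of \<open>b + a * s\<close> and its
      conjugate \<open>b - a * s\<close>.\<close>
    define N where "N = b\<^sup>2 - a\<^sup>2 * s\<^sup>2"
    assume "x \<noteq> 0"
    have "N \<noteq> 0"
    proof
      assume "N = 0"
      then have "(a * s)\<^sup>2 = b\<^sup>2"
        by (simp add: N_def power_mult_distrib)
      then have "a * s = b \<or> a * s = - b"
        by (simp add: power2_eq_iff)
      then have "a * s \<in> \<rat>"
        using rat by auto
      \<comment> \<open>With \<open>a = 0\<close>, a vanishing norm would give \<open>b = 0\<close>
        and hence \<open>x = 0\<close>.\<close>
      moreover have "a \<noteq> 0"
        using \<open>x \<noteq> 0\<close> \<open>N = 0\<close> by (auto simp: x N_def)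
      ultimately have "inverse a * (a * s) \<in> \<rat>"
        using rat by (intro Rats_mult[where b = "a * s"]) auto
      also have "inverse a * (a * s) = s"
        using \<open>a \<noteq> 0\<close> by simp
      finally show False
        using assms(2) by contradiction
    qed
    moreover have "x * (b - a * s) = N"
      by (simp add: x N_def algebra_simps power2_eq_square)
    ultimately have "inverse x = (b - a * s) / N"
      by (intro inverse_unique) simp
    also have "\<dots> = (- a / N) * s + b / N"
      by (simp add: diff_divide_distrib)
    finally have "inverse x = (- a / N) * s + b / N" .
    moreover have "N \<in> \<rat>"
      unfolding N_def using rat assms(1) by simp
    ultimately show "inverse x \<in> G"
      using rat by (simp only: G_I Rats_divide Rats_minus_iff[THEN iffD2])
  qed
  moreover have "\<rat> \<subseteq> G" "s \<in> G"
    using G_I[of 0] G_I[of 1 0] by auto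
  ultimately have "Q_adjoin {s} \<subseteq> G"
    by (intro Q_adjoin_least) auto
  moreover have "G \<subseteq> Q_adjoin {s}"
    unfolding G_def
    by (auto intro!: Q_adjoin_add Q_adjoin_mult intro: Rats_in_Q_adjoin generator_in_Q_adjoin)
  ultimately have "Q_adjoin {s} = G" ..
  moreover have "dimension 2 \<rat> G"
    unfolding G_eq[symmetric] numeral_2_eq_2
    using assms(2) zero_dim[of \<rat>] by (intro Suc_dim) (auto simp: line_1)
  ultimately show ?thesis
    using subfield_Q_adjoin[of "{s}"] unfolding quadratic_field_def by simp
qed

text \<open>In lowest terms \<open>a / b\<close>, the square of the denominator divides the square
  of the numerator, which forces \<open>b = 1\<close>. It shows that square roots of nonsquare
  integers are irrational.\<close>

lemma int_square_of_rat_square: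
  fixes s :: "'a::field_char_0"
  assumes "s \<in> \<rat>" and "s\<^sup>2 = of_int d"
  obtains k :: int where "d = k\<^sup>2"
proof -
  obtain a b :: int where ab: "b > 0" "coprime a b" "s = of_int a / of_int b"
    using assms(1) by (rule Rats_cases')
  have "(of_int (a\<^sup>2) :: 'a) = of_int (d * b\<^sup>2)"
    using assms(2) ab by (simp add: field_simps)
  then have eq: "a\<^sup>2 = d * b\<^sup>2"
    by (simp only: of_int_eq_iff)
  then have "b\<^sup>2 dvd a\<^sup>2"
    by simp
  then have "b dvd a"
    by simp
  with ab have "is_unit b"
    by (meson coprime_common_divisor dvd_refl)
  with ab have "b = 1"
    by simp
  with eq have "d = a\<^sup>2"
    by simp
  then show ?thesis
    by (rule that)
qed

lemma quadratic_field_csqrt_int: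
  assumes "\<nexists>k::int. d = k\<^sup>2"
  shows "quadratic_field (Q_adjoin {csqrt (of_int d)})"
proof (rule quadratic_field_Q_adjoin)
  show "csqrt (of_int d) \<notin> \<rat>"
    using assms int_square_of_rat_square[of "csqrt (of_int d)" d] by auto
qed simp

section \<open>Discriminants and derivatives at the roots\<close>

text \<open>Up to sign, the square root is the product of the differences of the roots.\<close>

lemma csqrt_discriminant_in_splitting_field:
  assumes "lead_coeff p = 1"
  shows "csqrt (discriminant p) \<in> splitting_field p"
proof -
  obtain \<alpha> where \<alpha>: "smult (lead_coeff p) (\<Prod>i<degree p. [:- \<alpha> i, 1:]) = p"
    by (rule complex_poly_decompose')
  then have p: "p = (\<Prod>i<degree p. [:- \<alpha> i, 1:])"
    unfolding assms smult_1_left by (rule sym)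
  let ?d = "\<Prod>j<degree p. \<Prod>i<j. \<alpha> i - \<alpha> j"
  have root: "\<alpha> i \<in> splitting_field p" if "i < degree p" for i
  proof -
    have "poly p (\<alpha> i) = 0"
      using that by (subst p) (auto simp: poly_prod)
    then show ?thesis
      unfolding splitting_field_def by (intro generator_in_Q_adjoin) simp
  qed
  then have d: "?d \<in> splitting_field p"
    unfolding splitting_field_def by (intro Q_adjoin_prod Q_adjoin_diff) simp_all
  have "discriminant p = discriminant (\<Prod>i<degree p. [:- \<alpha> i, 1:])"
    using p by (rule arg_cong)
  also have "\<dots> = (\<Prod>j<degree p. \<Prod>i<j. (\<alpha> i - \<alpha> j)\<^sup>2)"
    by (rule discriminant_prod_linear)
  finally have "(csqrt (discriminant p))\<^sup>2 = ?d\<^sup>2"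
    by (simp add: prod_power_distrib)
  then have "csqrt (discriminant p) = ?d \<or> csqrt (discriminant p) = - ?d"
    by (simp only: power2_eq_iff)
  with d show ?thesis
    unfolding splitting_field_def by (auto intro: Q_adjoin_uminus)
qed

text \<open>The derivative at a root is the product of its differences to the other roots. Each of
  the \<open>d choose 2\<close> pairs thus occurs twice with opposite signs, contributing minus its
  squared difference.\<close>

lemma prod_pderiv_at_roots:
  fixes \<alpha> :: "nat \<Rightarrow> 'a::idom"
  defines "p \<equiv> \<lambda>d. \<Prod>i<d. [:- \<alpha> i, 1:]"
  shows "(\<Prod>j<d. poly (pderiv (p d)) (\<alpha> j)) =
    (- 1) ^ (d choose 2) * (\<Prod>j<d. \<Prod>i<j. (\<alpha> i - \<alpha> j)\<^sup>2)"
proof (induction d)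
  case (Suc d)
  have p_Suc: "p (Suc d) = p d * [:- \<alpha> d, 1:]"
    by (simp add: p_def del: mult_pCons_right)
  have p_root: "poly (p d) (\<alpha> j) = 0" if "j < d" for j
    using that by (auto simp: p_def poly_prod)
  \<comment> \<open>By the product rule the new derivative is \<open>pderiv (p d)\<close> times the
    new linear factor, plus \<open>p d\<close>. At an old root only the first term survives, at
    \<open>\<alpha> d\<close> only the second.\<close>
  have "(\<Prod>j<Suc d. poly (pderiv (p (Suc d))) (\<alpha> j)) =
      (\<Prod>j<d. (\<alpha> j - \<alpha> d) * poly (pderiv (p d)) (\<alpha> j)) * (\<Prod>i<d. \<alpha> d - \<alpha> i)"
    unfolding p_Suc pderiv_mult
    by (simp add: pderiv_pCons p_root) (simp add: p_def poly_prod algebra_simps)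
  also have "(\<Prod>i<d. \<alpha> d - \<alpha> i) = (- 1) ^ d * (\<Prod>i<d. \<alpha> i - \<alpha> d)"
    using prod.distrib[of "\<lambda>_. - 1" "\<lambda>i. \<alpha> i - \<alpha> d" "{..<d}"] by simp
  also have "(\<Prod>j<d. (\<alpha> j - \<alpha> d) * poly (pderiv (p d)) (\<alpha> j)) * \<dots> =
      (- 1) ^ (d + (d choose 2)) * (\<Prod>j<Suc d. \<Prod>i<j. (\<alpha> i - \<alpha> j)\<^sup>2)"
    by (simp add: prod.distrib Suc.IH power_add prod_power_distrib power2_eq_square mult_ac
        del: prod.lessThan_Suc) (simp add: prod.distrib mult_ac)
  also have "d + (d choose 2) = Suc d choose 2"
    by (simp add: numeral_2_eq_2)
  finally show ?case .
qed (simp add: numeral_2_eq_2)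

section \<open>The polynomial \<open>f1 n\<close> and its discriminant\<close>

lemma poly_f1: "poly (map_poly of_int (f1 n)) x = (\<Sum>k=1..n. of_nat k * x ^ (n - k))"
  for x :: "'a::{comm_ring_1, ring_char_0}"
proof -
  have "map_poly of_int (f1 n) = (\<Sum>k=1..n. monom (of_nat k :: 'a) (n - k))"
    by (rule poly_eqI) (simp add: f1_def coeff_map_poly coeff_sum of_int_sum if_distrib cong: if_cong)
  then show ?thesis
    by (simp add: poly_sum poly_monom)
qed

text \<open>Proved pointwise by induction from the Horner step: the next polynomial is
  \<open>x\<close> times the previous one plus the constant \<open>n + 1\<close>. Pointwise equality
  suffices since the coefficient ring is an infinite domain.\<close>

lemma f1_mult_square:
  "[:- 1, 1:]\<^sup>2 * map_poly of_int (f1 n) =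
    monom (1 :: 'a::{idom, ring_char_0}) (Suc n) - [:- of_nat n, of_nat n + 1:]"
proof -
  have "(x - 1)\<^sup>2 * (\<Sum>k=1..n. of_nat k * x ^ (n - k)) = x ^ Suc n - (of_nat n + 1) * x + of_nat n"
    for x :: 'a
  proof (induction n)
    case (Suc n)
    have "(\<Sum>k=1..n. of_nat k * x ^ (Suc n - k)) = x * (\<Sum>k=1..n. of_nat k * x ^ (n - k))"
      unfolding sum_distrib_left by (intro sum.cong) (auto simp: Suc_diff_le)
    then have "(x - 1)\<^sup>2 * (\<Sum>k=1..Suc n. of_nat k * x ^ (Suc n - k)) =
        x * ((x - 1)\<^sup>2 * (\<Sum>k=1..n. of_nat k * x ^ (n - k))) + (x - 1)\<^sup>2 * (of_nat n + 1)"
      by (simp add: algebra_simps)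
    then show ?case
      unfolding Suc.IH by (simp add: algebra_simps power2_eq_square)
  qed (simp add: power2_eq_square)
  then show ?thesis
    by (intro poly_ext) (simp add: poly_f1 poly_monom algebra_simps)
qed

text \<open>Both facts are read off \<open>f1_mult_square\<close>: the power of degree
  \<open>n + 1\<close> dominates the linear part, and the factor of degree 2 is monic.\<close>

lemma degree_f1:
  assumes "n > 0"
  shows "degree (map_poly of_int (f1 n) :: 'a::{idom, ring_char_0} poly) = n - 1" (is "degree ?f = _")
    and "lead_coeff (map_poly of_int (f1 n) :: 'a poly) = 1"
proof -
  \<comment> \<open>The linear part is negated so that the rules for the degree and leading
    coefficient of a sum apply.\<close>
  let ?g = "monom (1 :: 'a) (Suc n)" and ?h = "- [:- of_nat n, of_nat n + 1 :: 'a:]"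
  note minus_pCons [simp del]
  have deg_less: "degree ?h < degree ?g"
    using assms by (simp add: degree_monom_eq)
  then have "degree (?g + ?h) = degree ?g"
    by (rule degree_add_eq_left)
  then have deg: "degree (?g - - ?h) = Suc n"
    by (simp add: degree_monom_eq)
  have lead: "lead_coeff (?g - - ?h) = 1"
    using lead_coeff_add_le[OF deg_less] deg by (simp add: degree_monom_eq add.commute)
  from lead show "lead_coeff ?f = 1"
    unfolding minus_minus f1_mult_square[symmetric] lead_coeff_mult lead_coeff_power by simp
  then have "?f \<noteq> 0"
    by auto
  with deg show "degree ?f = n - 1"
    unfolding minus_minus f1_mult_square[symmetric] by (subst (asm) degree_mult_eq) (auto simp: degree_power_eq)
qed

text \<open>Signs are chosen so that the factors \<open>- a\<close> and \<open>1 - a\<close> multiply to \<open>f(0)\<close> and \<open>f(1)\<close>.\<close>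

lemma pderiv_f1_at_root:
  fixes a :: "'a::field_char_0" and n :: nat
  defines "f \<equiv> map_poly of_int (f1 n)"
  assumes "poly f a = 0" and "a \<noteq> 1"
  shows "(- a) * (1 - a) * poly (pderiv f) a = of_nat n * of_nat (n + 1)"
proof -
  have "poly ([:- 1, 1:]\<^sup>2 * f) a = poly (monom 1 (Suc n) - [:- of_nat n, of_nat n + 1:]) a"
    unfolding f_def f1_mult_square ..
  then have pow: "a * a ^ n = (of_nat n + 1) * a - of_nat n"
    using assms(2) by (simp add: poly_monom algebra_simps)
  have "poly (pderiv ([:- 1, 1:]\<^sup>2 * f)) a =
      poly (pderiv (monom 1 (Suc n) - [:- of_nat n, of_nat n + 1:])) a"
    unfolding f_def f1_mult_square ..
  then have "(a - 1)\<^sup>2 * poly (pderiv f) a = (of_nat n + 1) * (a ^ n - 1)"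
    using assms(2)
    by (simp add: pderiv_mult pderiv_diff pderiv_monom pderiv_pCons poly_monom algebra_simps)
  then have "a * ((a - 1)\<^sup>2 * poly (pderiv f) a) = a * ((of_nat n + 1) * (a ^ n - 1))"
    by (rule arg_cong)
  also have "\<dots> = (of_nat n + 1) * (a * a ^ n - a)"
    by (simp add: algebra_simps)
  finally have "a * ((a - 1)\<^sup>2 * poly (pderiv f) a) = (of_nat n + 1) * (a * a ^ n - a)" .
  \<comment> \<open>By \<open>pow\<close>, \<open>a * a ^ n - a\<close> equals
    \<open>n * (a - 1)\<close>, so one factor \<open>a - 1\<close> can be cancelled
    afterwards.\<close>
  then have "(a - 1) * ((- a) * (1 - a) * poly (pderiv f) a) =
      (a - 1) * (of_nat n * of_nat (n + 1))"
    unfolding pow by (simp add: algebra_simps power2_eq_square)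
  with assms(3) show ?thesis
    unfolding mult_cancel_left by simp
qed

text \<open>The product of \<open>pderiv_f1_at_root\<close> over all roots, solved for the
  discriminant. Writing the index as \<open>m + 3\<close> keeps the exponents free of truncated
  subtraction; the degree is then \<open>m + 2\<close>.\<close>

lemma discriminant_f1:
  "discriminant (map_poly of_int (f1 (m + 3))) =
    (- 1) ^ ((m + 2) choose 2) * 2 * of_nat (m + 3) ^ m * of_nat (m + 4) ^ (m + 1)"
proof -
  define n where "n = m + 3"
  define f :: "complex poly" where "f = map_poly of_int (f1 n)"
  obtain \<alpha> where "smult (lead_coeff f) (\<Prod>i<degree f. [:- \<alpha> i, 1:]) = f"
    by (rule complex_poly_decompose')
  then have f: "f = (\<Prod>i<m + 2. [:- \<alpha> i, 1:])"
    using degree_f1[of n, where 'a = complex] by (simp add: f_def n_def)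
  have f_0: "poly f 0 = of_nat n"
  proof -
    have "poly ([:- 1, 1:]\<^sup>2 * f) 0 = of_nat n"
      unfolding f_def f1_mult_square by (simp add: poly_monom)
    then show ?thesis
      by simp
  qed
  have f_1: "2 * poly f 1 = of_nat (n * (n + 1))"
  proof -
    have "2 * poly f 1 = of_nat (2 * (\<Sum>k=1..n. k))"
      by (simp add: f_def poly_f1)
    also have "2 * (\<Sum>k=1..n. k) = n * (n + 1)"
      using Sum_Icc_nat[of 1 n] by simp
    finally show ?thesis .
  qed
  have root: "poly f (\<alpha> j) = 0" if "j < m + 2" for j
    using that unfolding f poly_prod by (intro prod_zero) auto
  \<comment> \<open>The relation at a root was obtained by cancelling \<open>a - 1\<close>, so the
    root 1 must be excluded; the value at 1 is nonzero.\<close>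
  have ne_1: "\<alpha> j \<noteq> 1" if "j < m + 2" for j
  proof
    assume "\<alpha> j = 1"
    then have "(of_nat (n * (n + 1)) :: complex) = 0"
      using root[OF that] f_1 by simp
    then show False
      by (simp only: of_nat_eq_0_iff) (simp add: n_def)
  qed
  have "(- \<alpha> j) * (1 - \<alpha> j) * poly (pderiv f) (\<alpha> j) = of_nat (n * (n + 1))" if "j < m + 2" for j
    using pderiv_f1_at_root[OF root[OF that, unfolded f_def] ne_1[OF that]]
    by (simp only: f_def of_nat_mult)
  then have "of_nat (n * (n + 1)) ^ (m + 2) =
      (\<Prod>j<m + 2. (- \<alpha> j) * (1 - \<alpha> j) * poly (pderiv f) (\<alpha> j))"
    by simp
  also have "\<dots> = poly f 0 * poly f 1 * (\<Prod>j<m + 2. poly (pderiv f) (\<alpha> j))"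
  proof -
    have "poly f 0 = (\<Prod>j<m + 2. - \<alpha> j)" "poly f 1 = (\<Prod>j<m + 2. 1 - \<alpha> j)"
      unfolding f poly_prod by simp_all
    then show ?thesis
      by (simp only: prod.distrib)
  qed
  also have "(\<Prod>j<m + 2. poly (pderiv f) (\<alpha> j)) =
      (- 1) ^ ((m + 2) choose 2) * discriminant f"
    unfolding f discriminant_prod_linear by (rule prod_pderiv_at_roots)
  finally have "2 * of_nat (n * (n + 1)) ^ (m + 2) =
      of_nat n * (2 * poly f 1) * ((- 1) ^ ((m + 2) choose 2) * discriminant f)"
    by (simp add: f_0)
  then have eq: "2 * of_nat (n * (n + 1)) ^ (m + 2) =
      of_nat n * of_nat (n * (n + 1)) * ((- 1) ^ ((m + 2) choose 2) * discriminant f)"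
    unfolding f_1 .
  define N M S :: complex
    where "N = of_nat n" and "M = of_nat (n + 1)" and "S = (- 1) ^ ((m + 2) choose 2)"
  have "N \<noteq> 0" "M \<noteq> 0"
    unfolding N_def M_def of_nat_eq_0_iff by (simp_all add: n_def)
  have "S * S = 1"
    unfolding S_def by (simp flip: power_mult_distrib)
  have "2 * (N * M) ^ (m + 2) = N * (N * M) * (S * discriminant f)"
    using eq by (simp only: of_nat_mult N_def M_def S_def)
  \<comment> \<open>Splitting off the values at 0 and 1 removes two powers of \<open>N\<close> and
    one of \<open>M\<close>.\<close>
  then have "N * (N * M) * (2 * N ^ m * M ^ (m + 1)) = N * (N * M) * (S * discriminant f)"
    by (simp add: power_mult_distrib power2_eq_square mult_ac)
  then have "2 * N ^ m * M ^ (m + 1) = S * discriminant f"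
    using \<open>N \<noteq> 0\<close> \<open>M \<noteq> 0\<close> by (simp only: mult_cancel_left) simp
  then have "S * (2 * N ^ m * M ^ (m + 1)) = S * S * discriminant f"
    by (simp only: mult.assoc)
  then have "discriminant f = S * 2 * N ^ m * M ^ (m + 1)"
    by (simp only: \<open>S * S = 1\<close> mult_1_left mult.assoc)
  moreover have "n + 1 = m + 4"
    by (simp add: n_def)
  ultimately show ?thesis
    by (simp only: N_def M_def S_def f_def n_def)
qed

section \<open>The discriminant modulo rational squares, and the four residue classes\<close>

text \<open>Of the consecutive exponents \<open>n - 3\<close> and \<open>n - 2\<close> exactly one
  is odd, so a single factor \<open>n + 1\<close> or \<open>n\<close> survives modulo squares. With
  its sign it is \<open>2 * d\<close>, and the remaining 2 of the discriminant completes
  \<open>4 * d\<close>.\<close>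

lemma Q_adjoin_csqrt_discriminant_f1:
  assumes "n \<ge> 3"
    and "(- 1) ^ ((n - 1) choose 2) * int (if odd n then n + 1 else n) = 2 * d"
  shows "Q_adjoin {csqrt (discriminant (map_poly of_int (f1 n)))} = Q_adjoin {csqrt (of_int d)}"
proof -
  obtain m where n: "n = m + 3"
    using assms(1) by (metis le_add_diff_inverse2)
  define x y s :: complex
    where "x = of_nat (m + 3)" and "y = of_nat (m + 4)" and "s = (- 1) ^ ((m + 2) choose 2)"
  have disc: "discriminant (map_poly of_int (f1 n)) = s * 2 * x ^ m * y ^ (m + 1)"
    unfolding n x_def y_def s_def by (rule discriminant_f1)
  have "x \<noteq> 0" "y \<noteq> 0" and rat: "x \<in> \<rat>" "y \<in> \<rat>"
    unfolding x_def y_def of_nat_eq_0_iff by simp_all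
  have "complex_of_int ((- 1) ^ ((n - 1) choose 2) * int (if odd n then n + 1 else n)) =
      of_int (2 * d)"
    using assms(2) by (rule arg_cong)
  moreover have "s = (- 1) ^ ((n - 1) choose 2)" "x = of_nat n" "y = of_nat (n + 1)"
    by (simp_all add: s_def x_def y_def n)
  ultimately have d: "s * (if odd n then y else x) = 2 * of_int d"
    by (simp split: if_splits)
  obtain c where "c \<in> \<rat>" "c \<noteq> 0"
    and "discriminant (map_poly of_int (f1 n)) = c\<^sup>2 * of_int d"
  proof (cases "even m")
    case True
    \<comment> \<open>Here \<open>n\<close> is odd, and the surviving factor is \<open>y\<close>,
      that is \<open>n + 1\<close>.\<close>
    then obtain i where m: "m = 2 * i" ..
    have "s * 2 * x ^ m * y ^ (m + 1) = 2 * (x ^ i)\<^sup>2 * (y ^ i)\<^sup>2 * (s * y)"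
    proof -
      have "x ^ m = (x ^ i)\<^sup>2" "y ^ (m + 1) = y * (y ^ i)\<^sup>2"
        by (simp_all add: m power_even_eq)
      then show ?thesis
        by (simp only: mult_ac)
    qed
    also have "s * y = 2 * of_int d"
      using d True unfolding n by simp
    finally have "discriminant (map_poly of_int (f1 n)) = (2 * x ^ i * y ^ i)\<^sup>2 * of_int d"
      unfolding disc by (simp add: power_mult_distrib mult_ac)
    with \<open>x \<noteq> 0\<close> \<open>y \<noteq> 0\<close> rat show ?thesis
      by (intro that[of "2 * x ^ i * y ^ i"]) auto
  next
    case False
    then obtain i where m: "m = 2 * i + 1"
      by (rule oddE)
    have "s * 2 * x ^ m * y ^ (m + 1) = 2 * (x ^ i)\<^sup>2 * (y ^ (i + 1))\<^sup>2 * (s * x)"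
    proof -
      have "x ^ m = x * (x ^ i)\<^sup>2"
        by (simp add: m power_even_eq)
      moreover have "y ^ (m + 1) = (y ^ (i + 1))\<^sup>2"
        unfolding power_even_eq[symmetric] by (simp add: m)
      ultimately show ?thesis
        by (simp only: mult_ac)
    qed
    also have "s * x = 2 * of_int d"
      using d False unfolding n by simp
    finally have "discriminant (map_poly of_int (f1 n)) = (2 * x ^ i * y ^ (i + 1))\<^sup>2 * of_int d"
      unfolding disc by (simp add: power_mult_distrib mult_ac)
    with \<open>x \<noteq> 0\<close> \<open>y \<noteq> 0\<close> rat show ?thesis
      by (intro that[of "2 * x ^ i * y ^ (i + 1)"]) auto
  qed
  then show ?thesis
    by (simp only:) (rule Q_adjoin_csqrt_mult_square)
qed

text \<open>This determines the sign of the discriminant. Since \<open>Suc n choose 2\<close> is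
  \<open>n\<close> plus \<open>n choose 2\<close>, the parity can be followed modulo 4.\<close>

lemma even_choose_2_iff: "even (n choose 2) \<longleftrightarrow> n mod 4 = 0 \<or> n mod 4 = 1"
proof (induction n)
  case (Suc n)
  define t where "t = n choose 2"
  have "Suc n choose 2 = n + t"
    by (simp add: t_def numeral_2_eq_2)
  moreover have "even t \<longleftrightarrow> n mod 4 = 0 \<or> n mod 4 = 1"
    using Suc by (simp add: t_def)
  ultimately show ?case
    by (simp only:) presburger
qed (simp add: numeral_2_eq_2)

theorem corollary3p1:
  fixes n :: nat and l :: int
  defines "f \<equiv> map_poly complex_of_int (f1 n)"
  defines "F \<equiv> Q_adjoin {csqrt (discriminant f)}"
  assumes "n > 3"
    and "int n \<in> {4 * l, 4 * l + 1, 4 * l + 2, 4 * l + 3}"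
    and "int n \<in> {4 * l + 1, 4 * l + 2} \<Longrightarrow> \<not> (\<exists>k::int. 2 * l + 1 = k\<^sup>2)"
  shows "quadratic_field F \<and> F \<subseteq> splitting_field f \<and>
    (int n = 4 * l \<longrightarrow> F = Q_adjoin {csqrt (of_int (- 2 * l))}) \<and>
    (int n = 4 * l + 1 \<longrightarrow> F = Q_adjoin {csqrt (of_int (2 * l + 1))}) \<and>
    (int n = 4 * l + 2 \<longrightarrow> F = Q_adjoin {csqrt (of_int (2 * l + 1))}) \<and>
    (int n = 4 * l + 3 \<longrightarrow> F = Q_adjoin {csqrt (of_int (- 2 * (l + 1)))})"
proof -
  \<comment> \<open>This makes \<open>- 2 * l\<close> and \<open>- 2 * (l + 1)\<close> negative,
    hence nonsquare; for \<open>2 * l + 1\<close> nonsquareness is the assumption of the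
    theorem.\<close>
  have "l \<ge> 1"
    using assms(3,4) by auto
  have "csqrt (discriminant f) \<in> splitting_field f"
    using assms(3) unfolding f_def by (intro csqrt_discriminant_in_splitting_field degree_f1) simp
  then have subset: "F \<subseteq> splitting_field f"
    unfolding F_def splitting_field_def by (intro Q_adjoin_mono) simp
  have F_eq: "F = Q_adjoin {csqrt (of_int d)}"
    if "(- 1) ^ ((n - 1) choose 2) * int (if odd n then n + 1 else n) = 2 * d" for d
    unfolding F_def f_def using assms(3) that
    by (intro Q_adjoin_csqrt_discriminant_f1) simp_all
  have negative_not_square: "\<nexists>k::int. d = k\<^sup>2" if "d < 0" for d
    using that by (metis not_less zero_le_power2)
  \<comment> \<open>A natural-number copy of \<open>l\<close>, so that the residue of
    \<open>n - 1\<close> modulo 4 can be computed in \<open>nat\<close>.\<close>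
  define k where "k = nat l"
  have l: "l = int k" and "k \<ge> 1"
    using \<open>l \<ge> 1\<close> by (simp_all add: k_def)
  have "n = 4 * k \<or> n = 4 * k + 1 \<or> n = 4 * k + 2 \<or> n = 4 * k + 3"
    using assms(4) unfolding l insert_iff empty_iff by presburger
  then consider
    "n = 4 * k" | "n = 4 * k + 1" | "n = 4 * k + 2" | "n = 4 * k + 3"
    by blast
  then show ?thesis
  proof cases
    case 1
    \<comment> \<open>This form exhibits the residue 3; with \<open>k \<ge> 1\<close> the
      subtraction is exact.\<close>
    then have "n - 1 = 4 * (k - 1) + 3"
      using \<open>k \<ge> 1\<close> by simp
    with 1 have "odd ((n - 1) choose 2)" "even n"
      unfolding even_choose_2_iff by simp_all
    then have "F = Q_adjoin {csqrt (of_int (- 2 * l))}"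
      using 1 l by (intro F_eq) simp
    moreover have "quadratic_field (Q_adjoin {csqrt (of_int (- 2 * l))})"
      using \<open>l \<ge> 1\<close> by (intro quadratic_field_csqrt_int negative_not_square) simp
    ultimately show ?thesis
      using subset 1 l by simp
  next
    case 2
    then have "n - 1 = 4 * k"
      using \<open>k \<ge> 1\<close> by simp
    with 2 have "even ((n - 1) choose 2)" "odd n"
      unfolding even_choose_2_iff by simp_all
    then have "F = Q_adjoin {csqrt (of_int (2 * l + 1))}"
      using 2 l by (intro F_eq) simp
    moreover have "quadratic_field (Q_adjoin {csqrt (of_int (2 * l + 1))})"
      using 2 l by (intro quadratic_field_csqrt_int assms(5)) simp
    ultimately show ?thesis
      using subset 2 l by simp
  next
    case 3
    then have "n - 1 = 4 * k + 1"
      using \<open>k \<ge> 1\<close> by simp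
    with 3 have "even ((n - 1) choose 2)" "even n"
      unfolding even_choose_2_iff by simp_all
    then have "F = Q_adjoin {csqrt (of_int (2 * l + 1))}"
      using 3 l by (intro F_eq) simp
    moreover have "quadratic_field (Q_adjoin {csqrt (of_int (2 * l + 1))})"
      using 3 l by (intro quadratic_field_csqrt_int assms(5)) simp
    ultimately show ?thesis
      using subset 3 l by simp
  next
    case 4
    then have "n - 1 = 4 * k + 2"
      using \<open>k \<ge> 1\<close> by simp
    then have "(n - 1) mod 4 = 2"
      by (simp only: mod_mult_self4) simp
    with 4 have "odd ((n - 1) choose 2)" "odd n"
      unfolding even_choose_2_iff by simp_all
    then have "F = Q_adjoin {csqrt (of_int (- 2 * (l + 1)))}"
      using 4 l by (intro F_eq) simp
    moreover have "quadratic_field (Q_adjoin {csqrt (of_int (- 2 * (l + 1)))})"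
      using \<open>l \<ge> 1\<close> by (intro quadratic_field_csqrt_int negative_not_square) simp
    ultimately show ?thesis
      using subset 4 l by simp
  qed
qed

end
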